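(* Let $f\in\mathcal{A}_\emptyset$ be a homogeneous graph combination of degree $d$ that is a sum of squares (sos). Then $f$ has a sos expression $f=\sum_i[[a_i^2]]$ (a finite sum with $a_i\in\mathcal{A}$) in which, for every $i$, all cross products of terms in $a_i$ have degree $d$; that is, for any constituent graphs $H,H'$ of the same $a_i$ (the case $H=H'$ included), $\deg(HH')=d$.
   Context: All graphs are finite and simple (no loops or multiple edges). A graph is partially labeled if some subset of its vertices (possibly empty, possibly all) carries pairwise distinct labels from $\mathbb{N}=\{1,2,3,\dots\}$, each vertex having at most one label; it is unlabeled if no vertex is labeled. Partially labeled graphs are identified up to label-preserving isomorphism. $\mathcal{A}$ is the real vector space of formal finite $\mathbb{R}$-linear combinations ("graph combinations") of partially labeled graphs without isolated vertices, including the empty graph, denoted $1$. The product $H_1H_2$ of two partially labeled graphs is obtained by taking the disjoint union, identifying vertices carrying the same label, and keeping only one copy of any doubled edge; extended bilinearly, this makes $\mathcal{A}$ a commutative $\mathbb{R}$-algebra with identity $1$. $\mathcal{A}_\emptyset$ is the subalgebra spanned by unlabeled graphs (where the product is disjoint union). The linear map $[[\cdot]]:\mathcal{A}\to\mathcal{A}_\emptyset$ removes all labels. For a graph combination $a=\sum_j\alpha_jH_j$ with the $H_j$ distinct and all $\alpha_j\ne0$, the $\alpha_jH_j$ are its terms and the $H_j$ its constituent graphs. The degree $\deg(H)$ of a graph $H$ is its number of edges, and the degree of a term is that of its graph. A graph combination is homogeneous of degree $d$ if all its terms have degree $d$. A sum of squares (sos) is an element of $\mathcal{A}_\emptyset$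 of the form $\sum_i[[a_i^2]]$, a finite sum with $a_i\in\mathcal{A}$. *)

theory Defs
  imports Complex_Main "HOL-Library.Poly_Mapping"
begin

text \<open>
  A labeled vertex is identified with its label; unlabeled vertices carry arbitrary names,
  which are factored out below.  A graph without isolated vertices is determined by its edge
  set, so a representative of a partially labeled graph is a finite set of two-element
  vertex sets.  Labels are positive, hence \<open>Lab 0\<close> is excluded.
\<close>

datatype vertex = Lab nat | Unl nat

primrec label :: "vertex \<Rightarrow> nat option" where
  "label (Lab n) = Some n"
| "label (Unl k) = None"

type_synonym edges = "vertex set set"

definition pl_edges :: "edges \<Rightarrow> bool" where
  "pl_edges E \<longleftrightarrow> finite E \<and> (\<forall>e\<in>E. card e = 2) \<and> Lab 0 \<notin> \<Union>E"

definition label_iso :: "edges \<Rightarrow> edges \<Rightarrow> bool" where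
  "label_iso E E' \<longleftrightarrow> pl_edges E \<and> pl_edges E' \<and>
     (\<exists>\<phi>. bij_betw \<phi> (\<Union>E) (\<Union>E') \<and> (\<forall>v\<in>\<Union>E. label (\<phi> v) = label v) \<and> (`) \<phi> ` E = E')"

lemma pl_edges_image:
  assumes "pl_edges E" "inj_on \<phi> (\<Union>E)" "\<forall>v\<in>\<Union>E. \<phi> v \<noteq> Lab 0"
  shows "pl_edges ((`) \<phi> ` E)"
proof -
  have "card (\<phi> ` e) = 2" if "e \<in> E" for e
    using assms that card_image[of \<phi> e] inj_on_subset[of \<phi> "\<Union>E" e] by (auto simp: pl_edges_def)
  then show ?thesis using assms by (auto simp: pl_edges_def) (metis UnionI)
qed

lemma label_pres_not_Lab0: "label w = label v \<Longrightarrow> v \<noteq> Lab 0 \<Longrightarrow> w \<noteq> Lab 0"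
  by (cases v; cases w) auto

lemma label_iso_image:
  assumes "pl_edges E" "inj_on \<phi> (\<Union>E)" "\<And>v. v \<in> \<Union>E \<Longrightarrow> label (\<phi> v) = label v"
  shows "label_iso E ((`) \<phi> ` E)"
proof -
  have "pl_edges ((`) \<phi> ` E)"
    using assms by (intro pl_edges_image) (auto simp: pl_edges_def dest!: label_pres_not_Lab0)
  moreover have "bij_betw \<phi> (\<Union>E) (\<Union>((`) \<phi> ` E))"
    using assms(2) by (auto simp: bij_betw_def)
  ultimately show ?thesis using assms unfolding label_iso_def by blast
qed

lemma label_isoE:
  assumes "label_iso E E'"
  obtains \<phi> where "pl_edges E" "inj_on \<phi> (\<Union>E)" "\<And>v. v \<in> \<Union>E \<Longrightarrow> label (\<phi> v) = label v"
    "E' = (`) \<phi> ` E"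
  using assms unfolding label_iso_def bij_betw_def by blast

lemma label_iso_refl: "pl_edges E \<Longrightarrow> label_iso E E"
  using label_iso_image[of E id] by simp

lemma label_iso_trans:
  assumes "label_iso A B" "label_iso B C"
  shows "label_iso A C"
proof -
  obtain \<phi> where 1: "pl_edges A" "inj_on \<phi> (\<Union>A)" "\<And>v. v \<in> \<Union>A \<Longrightarrow> label (\<phi> v) = label v"
    "B = (`) \<phi> ` A" using assms(1) by (rule label_isoE) blast
  obtain \<psi> where 2: "inj_on \<psi> (\<Union>B)" "\<And>v. v \<in> \<Union>B \<Longrightarrow> label (\<psi> v) = label v"
    "C = (`) \<psi> ` B" using assms(2) by (rule label_isoE) blast
  have V: "\<Union>B = \<phi> ` \<Union>A" using 1(4) by blast
  have "C = (`) (\<psi> \<circ> \<phi>) ` A" using 1(4) 2(3) by (simp add: image_image image_comp)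
  moreover have "label_iso A ((`) (\<psi> \<circ> \<phi>) ` A)"
  proof (rule label_iso_image)
    show "inj_on (\<psi> \<circ> \<phi>) (\<Union>A)" using 1(2) 2(1) V by (simp add: comp_inj_on)
    show "label ((\<psi> \<circ> \<phi>) v) = label v" if "v \<in> \<Union>A" for v
      using 1(3)[OF that] 2(2)[of "\<phi> v"] V that by auto
  qed (fact 1)
  ultimately show ?thesis by simp
qed

lemma label_iso_sym:
  assumes "label_iso A B"
  shows "label_iso B A"
proof -
  obtain \<phi> where 1: "pl_edges A" "inj_on \<phi> (\<Union>A)" "\<And>v. v \<in> \<Union>A \<Longrightarrow> label (\<phi> v) = label v"
    "B = (`) \<phi> ` A" using assms(1) by (rule label_isoE) blast
  have V: "\<Union>B = \<phi> ` \<Union>A" using 1(4) by blast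
  let ?\<psi> = "inv_into (\<Union>A) \<phi>"
  have "?\<psi> ` \<phi> ` e = e" if "e \<in> A" for e
    using 1(2) that by (metis Union_upper inv_into_image_cancel)
  then have "A = (`) ?\<psi> ` B" by (auto simp: 1(4) image_iff)
  moreover have "label_iso B ((`) ?\<psi> ` B)"
  proof (rule label_iso_image)
    show "pl_edges B" using assms by (simp add: label_iso_def)
    show "inj_on ?\<psi> (\<Union>B)" using V by (simp add: inj_on_inv_into)
    show "label (?\<psi> v) = label v" if "v \<in> \<Union>B" for v
      using that 1(2,3) unfolding V by (metis f_inv_into_f inv_into_into)
  qed
  ultimately show ?thesis by simp
qed

quotient_type plgraph = "vertex set set" / partial: label_iso
proof (rule part_equivpI)
  have "pl_edges {}" by (simp add: pl_edges_def)
  then show "\<exists>E. label_iso E E" using label_iso_refl by blast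
  show "symp label_iso" by (simp add: sympI label_iso_sym)
  show "transp label_iso" by (meson transpI label_iso_trans)
qed

lift_definition deg :: "plgraph \<Rightarrow> nat" is card
proof (erule label_isoE)
  fix A B :: edges and \<phi>
  assume *: "inj_on \<phi> (\<Union>A)" "B = (`) \<phi> ` A"
  have "inj_on ((`) \<phi>) A" using *(1) by (meson inj_on_def inj_on_image_eq_iff Union_upper)
  then show "card A = card B" using *(2) by (simp add: card_image)
qed

lift_definition unlabeled :: "plgraph \<Rightarrow> bool" is "\<lambda>E. \<forall>v\<in>\<Union>E. label v = None"
proof (erule label_isoE)
  fix A B :: edges and \<phi>
  assume *: "\<And>v. v \<in> \<Union>A \<Longrightarrow> label (\<phi> v) = label v" "B = (`) \<phi> ` A"
  have "\<Union>B = \<phi> ` \<Union>A" using *(2) by blast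
  then show "(\<forall>v\<in>\<Union>A. label v = None) = (\<forall>v\<in>\<Union>B. label v = None)" using *(1) by auto
qed

text \<open>Forgetting labels: the even names serve as fresh names for the formerly labeled vertices.\<close>

primrec unlabel_vertex :: "vertex \<Rightarrow> vertex" where
  "unlabel_vertex (Lab n) = Unl (2 * n)"
| "unlabel_vertex (Unl k) = Unl (2 * k + 1)"

lemma inj_unlabel_vertex: "inj unlabel_vertex"
proof (rule injI)
  fix u v show "unlabel_vertex u = unlabel_vertex v \<Longrightarrow> u = v"
    by (cases u; cases v) (auto, presburger+)
qed

lemma label_unlabel_vertex [simp]: "label (unlabel_vertex v) = None"
  by (cases v) auto

lift_definition unlabel :: "plgraph \<Rightarrow> plgraph" is "\<lambda>E. (`) unlabel_vertex ` E"
proof (erule label_isoE)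
  fix A B :: edges and \<phi>
  assume *: "pl_edges A" "inj_on \<phi> (\<Union>A)" "B = (`) \<phi> ` A"
  let ?u = unlabel_vertex
  let ?\<psi> = "?u \<circ> \<phi> \<circ> inv ?u"
  have "(`) ?u ` B = (`) ?\<psi> ` (`) ?u ` A"
    by (simp add: *(3) image_image inj_unlabel_vertex)
  moreover have "label_iso ((`) ?u ` A) ((`) ?\<psi> ` (`) ?u ` A)"
  proof (rule label_iso_image)
    show "pl_edges ((`) ?u ` A)"
    proof (rule pl_edges_image)
      show "\<forall>v\<in>\<Union>A. ?u v \<noteq> Lab 0" by (metis label.simps(1) label_unlabel_vertex option.distinct(1))
    qed (use * inj_unlabel_vertex inj_on_subset in auto)
    show "inj_on ?\<psi> (\<Union>((`) ?u ` A))"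
    proof (rule inj_onI)
      fix x y assume "x \<in> \<Union>((`) ?u ` A)" "y \<in> \<Union>((`) ?u ` A)" and eq: "?\<psi> x = ?\<psi> y"
      then obtain a b where "x = ?u a" "y = ?u b" "a \<in> \<Union>A" "b \<in> \<Union>A" by blast
      moreover from this have "\<phi> a = \<phi> b"
        using eq inj_unlabel_vertex by (simp add: inj_eq)
      ultimately show "x = y" using *(2) by (metis inj_onD)
    qed
    show "label (?\<psi> v) = label v" if "v \<in> \<Union>((`) ?u ` A)" for v using that by auto
  qed
  ultimately show "label_iso ((`) ?u ` A) ((`) ?u ` B)" by simp
qed

text \<open>
  Gluing product: names of unlabeled vertices are made disjoint (even versus odd), so that the
  union of the edge sets identifies exactly the vertices with the same label and merges
  doubled edges.
\<close>

primrec rename :: "(nat \<Rightarrow> nat) \<Rightarrow> vertex \<Rightarrow> vertex" where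
  "rename g (Lab n) = Lab n"
| "rename g (Unl k) = Unl (g k)"

definition glue :: "edges \<Rightarrow> edges \<Rightarrow> edges" where
  "glue E E' = (`) (rename (\<lambda>k. 2 * k)) ` E \<union> (`) (rename (\<lambda>k. 2 * k + 1)) ` E'"

lemma label_rename [simp]: "label (rename g v) = label v"
  by (cases v) auto

lemma inj_rename: "inj g \<Longrightarrow> inj (rename g)"
proof (rule injI)
  fix u v assume "inj g" "rename g u = rename g v" then show "u = v"
    by (cases u; cases v) (auto dest: injD)
qed

lemma label_eq_SomeD: "label u = Some n \<Longrightarrow> u = Lab n"
  by (cases u) auto

lemma label_iso_Un:
  assumes A: "pl_edges A" "inj_on \<phi> (\<Union>A)" "\<And>v. v \<in> \<Union>A \<Longrightarrow> label (\<phi> v) = label v"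
    and B: "pl_edges B" "inj_on \<psi> (\<Union>B)" "\<And>v. v \<in> \<Union>B \<Longrightarrow> label (\<psi> v) = label v"
    and disj: "\<And>v. v \<in> \<Union>A \<Longrightarrow> v \<in> \<Union>B \<Longrightarrow> label v \<noteq> None"
    and disj': "\<And>u v. u \<in> \<Union>A \<Longrightarrow> v \<in> \<Union>B \<Longrightarrow> \<phi> u = \<psi> v \<Longrightarrow> label u \<noteq> None"
  shows "label_iso (A \<union> B) ((`) \<phi> ` A \<union> (`) \<psi> ` B)"
proof -
  define \<chi> where "\<chi> v = (if v \<in> \<Union>A then \<phi> v else \<psi> v)" for v
  have \<chi>A: "\<chi> v = \<phi> v" if "v \<in> \<Union>A" for v using that by (auto simp: \<chi>_def)
  have \<chi>B: "\<chi> v = \<psi> v" if vB: "v \<in> \<Union>B" for v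
  proof (cases "v \<in> \<Union>A")
    case True
    then obtain n where "label v = Some n" using disj[OF True vB] by (cases "label v") auto
    then have "\<phi> v = Lab n" "\<psi> v = Lab n"
      using A(3)[OF True] B(3)[OF vB] by (auto intro: label_eq_SomeD)
    then show ?thesis using True \<chi>A by simp
  qed (auto simp: \<chi>_def)
  have cross: "u = v" if uv: "u \<in> \<Union>A" "v \<in> \<Union>B" "\<phi> u = \<psi> v" for u v
  proof -
    obtain n where "label u = Some n" using disj'[OF uv] by (cases "label u") auto
    moreover from this have "label v = Some n"
      using A(3)[OF uv(1)] B(3)[OF uv(2)] uv(3) by simp
    ultimately show ?thesis using label_eq_SomeD by blast
  qed
  have "label_iso (A \<union> B) ((`) \<chi> ` (A \<union> B))"
  proof (rule label_iso_image)
    show "pl_edges (A \<union> B)" using A(1) B(1) by (auto simp: pl_edges_def)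
    show "inj_on \<chi> (\<Union>(A \<union> B))"
    proof (rule inj_onI)
      fix u v assume "u \<in> \<Union>(A \<union> B)" "v \<in> \<Union>(A \<union> B)" and eq: "\<chi> u = \<chi> v"
      then consider "u \<in> \<Union>A" "v \<in> \<Union>A" | "u \<in> \<Union>A" "v \<in> \<Union>B" | "u \<in> \<Union>B" "v \<in> \<Union>A"
        | "u \<in> \<Union>B" "v \<in> \<Union>B" by (metis UnE Union_Un_distrib)
      then show "u = v"
      proof cases
        case 1 then show ?thesis using eq \<chi>A A(2) by (metis inj_onD)
      next
        case 2 then show ?thesis using eq \<chi>A \<chi>B cross by metis
      next
        case 3 then show ?thesis using eq \<chi>A \<chi>B cross by metis
      next
        case 4 then show ?thesis using eq \<chi>B B(2) by (metis inj_onD)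
      qed
    qed
    show "label (\<chi> v) = label v" if "v \<in> \<Union>(A \<union> B)" for v
      using that \<chi>A \<chi>B A(3) B(3) by (metis UnE Union_Un_distrib)
  qed
  moreover have "(`) \<chi> ` A = (`) \<phi> ` A"
    by (intro image_cong refl) (use \<chi>A in auto)
  moreover have "(`) \<chi> ` B = (`) \<psi> ` B"
    by (intro image_cong refl) (use \<chi>B in auto)
  ultimately show ?thesis by (simp add: image_Un)
qed

lemma inj_double: "inj (\<lambda>k::nat. 2 * k)" "inj (\<lambda>k::nat. 2 * k + 1)"
  by (auto simp: inj_def)

lemma pl_edges_rename: "inj g \<Longrightarrow> pl_edges A \<Longrightarrow> pl_edges ((`) (rename g) ` A)"
  using label_iso_image[of A "rename g"] inj_on_subset[OF inj_rename[of g]]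
  by (auto simp: label_iso_def)

lemma pl_edges_glue: "pl_edges A \<Longrightarrow> pl_edges B \<Longrightarrow> pl_edges (glue A B)"
  using pl_edges_rename[OF inj_double(1), of A] pl_edges_rename[OF inj_double(2), of B]
  by (auto simp: glue_def pl_edges_def)

lemma rename_parity:
  "rename (\<lambda>k. 2 * k) u = rename (\<lambda>k. 2 * k + 1) v \<Longrightarrow> label u \<noteq> None"
  by (cases u; cases v) (auto, presburger)

lemma label_iso_glue:
  assumes A: "pl_edges A" "inj_on \<phi> (\<Union>A)" "\<And>v. v \<in> \<Union>A \<Longrightarrow> label (\<phi> v) = label v"
    and B: "pl_edges B" "inj_on \<psi> (\<Union>B)" "\<And>v. v \<in> \<Union>B \<Longrightarrow> label (\<psi> v) = label v"
    and disj: "\<And>u v. u \<in> \<Union>A \<Longrightarrow> v \<in> \<Union>B \<Longrightarrow> \<phi> u = \<psi> v \<Longrightarrow> label u \<noteq> None"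
  shows "label_iso (glue A B) ((`) \<phi> ` A \<union> (`) \<psi> ` B)"
proof -
  let ?f = "rename (\<lambda>k. 2 * k)" and ?g = "rename (\<lambda>k. 2 * k + 1)"
  have inj: "inj ?f" "inj ?g" by (intro inj_rename inj_double)+
  have *: "label_iso ((`) ?f ` A \<union> (`) ?g ` B)
      ((`) (\<phi> \<circ> inv ?f) ` (`) ?f ` A \<union> (`) (\<psi> \<circ> inv ?g) ` (`) ?g ` B)"
  proof (rule label_iso_Un)
    show "pl_edges ((`) ?f ` A)" "pl_edges ((`) ?g ` B)"
      using A(1) B(1) pl_edges_rename inj_double by blast+
    show "inj_on (\<phi> \<circ> inv ?f) (\<Union>((`) ?f ` A))"
      using A(2) inj(1) inj_on_imageI[of "\<phi> \<circ> inv ?f" ?f "\<Union>A"]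
      by (simp add: comp_assoc image_Union)
    show "inj_on (\<psi> \<circ> inv ?g) (\<Union>((`) ?g ` B))"
      using B(2) inj(2) inj_on_imageI[of "\<psi> \<circ> inv ?g" ?g "\<Union>B"]
      by (simp add: comp_assoc image_Union)
    show "label ((\<phi> \<circ> inv ?f) v) = label v" if v: "v \<in> \<Union>((`) ?f ` A)" for v
    proof -
      obtain a where "v = ?f a" "a \<in> \<Union>A" using v by blast
      then show ?thesis using A(3)[of a] inj(1) by simp
    qed
    show "label ((\<psi> \<circ> inv ?g) v) = label v" if v: "v \<in> \<Union>((`) ?g ` B)" for v
    proof -
      obtain b where "v = ?g b" "b \<in> \<Union>B" using v by blast
      then show ?thesis using B(3)[of b] inj(2) by simp
    qed
    show "label v \<noteq> None" if v: "v \<in> \<Union>((`) ?f ` A)" "v \<in> \<Union>((`) ?g ` B)" for v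
    proof -
      obtain a b where ab: "v = ?f a" "v = ?g b" using v by blast
      then have "label a \<noteq> None" using rename_parity[of a b] by simp
      then show ?thesis using ab(1) by simp
    qed
    show "label u \<noteq> None" if uv: "u \<in> \<Union>((`) ?f ` A)" "v \<in> \<Union>((`) ?g ` B)"
      "(\<phi> \<circ> inv ?f) u = (\<psi> \<circ> inv ?g) v" for u v
    proof -
      obtain a b where "u = ?f a" "v = ?g b" "a \<in> \<Union>A" "b \<in> \<Union>B" using uv by blast
      then show ?thesis using uv(3) disj[of a b] inj by simp
    qed
  qed
  then show ?thesis using inj by (simp add: glue_def image_image)
qed

instantiation plgraph :: comm_monoid_add
begin

text \<open>
  The monoid operation is the gluing product, with the empty graph as unit.  It is written
  additively so that finitely supported functions on \<open>plgraph\<close>, with the convolution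
  product, form the required algebra.
\<close>

lift_definition zero_plgraph :: plgraph is "{}"
  by (simp add: label_iso_refl pl_edges_def)

lift_definition plus_plgraph :: "plgraph \<Rightarrow> plgraph \<Rightarrow> plgraph" is glue
proof (elim label_isoE)
  fix A B A' B' :: edges and \<phi> \<psi>
  let ?f = "rename (\<lambda>k. 2 * k)" and ?g = "rename (\<lambda>k. 2 * k + 1)"
  have inj: "inj ?f" "inj ?g" by (intro inj_rename inj_double)+
  assume A: "pl_edges A" "inj_on \<phi> (\<Union>A)" "\<And>v. v \<in> \<Union>A \<Longrightarrow> label (\<phi> v) = label v"
      "A' = (`) \<phi> ` A"
    and B: "pl_edges B" "inj_on \<psi> (\<Union>B)" "\<And>v. v \<in> \<Union>B \<Longrightarrow> label (\<psi> v) = label v"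
      "B' = (`) \<psi> ` B"
  have "label_iso (glue A B) ((`) (?f \<circ> \<phi>) ` A \<union> (`) (?g \<circ> \<psi>) ` B)"
  proof (rule label_iso_glue)
    show "inj_on (?f \<circ> \<phi>) (\<Union>A)" "inj_on (?g \<circ> \<psi>) (\<Union>B)"
      using A(2) B(2) inj by (auto intro!: comp_inj_on intro: inj_on_subset)
    show "label u \<noteq> None" if "u \<in> \<Union>A" "v \<in> \<Union>B" "(?f \<circ> \<phi>) u = (?g \<circ> \<psi>) v" for u v
      using rename_parity[of "\<phi> u" "\<psi> v"] that A(3)[of u] by simp
  qed (use A B in auto)
  then show "label_iso (glue A B) (glue A' B')"
    by (simp add: glue_def A(4) B(4) image_image image_comp)
qed

instance
proof
  fix a b c :: plgraph
  let ?e = "\<lambda>k::nat. 2 * k" and ?o = "\<lambda>k::nat. 2 * k + 1"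
  let ?f = "rename ?e" and ?g = "rename ?o"
  have inj: "inj ?f" "inj ?g" by (intro inj_rename inj_double)+
  show "0 + a = a"
  proof transfer
    fix A :: edges assume "label_iso A A"
    then have A: "pl_edges A" by (simp add: label_iso_def)
    have "label_iso (glue {} A) ((`) id ` {} \<union> (`) id ` A)"
      using A by (intro label_iso_glue) (auto simp: pl_edges_def)
    then show "label_iso (glue {} A) A" by simp
  qed
  show "a + b = b + a"
  proof transfer
    fix A B :: edges assume "label_iso A A" "label_iso B B"
    then have A: "pl_edges A" "pl_edges B" by (simp_all add: label_iso_def)
    have "label_iso (glue A B) ((`) ?g ` A \<union> (`) ?f ` B)"
    proof (rule label_iso_glue)
      show "inj_on ?g (\<Union>A)" "inj_on ?f (\<Union>B)" using inj inj_on_subset by blast+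
      show "label u \<noteq> None" if "?g u = ?f v" for u v
        using rename_parity[of v u] that by (metis label_rename)
    qed (use A in auto)
    then show "label_iso (glue A B) (glue B A)" by (simp add: glue_def Un_commute)
  qed
  show "a + b + c = a + (b + c)"
  proof transfer
    fix A B C :: edges assume "label_iso A A" "label_iso B B" "label_iso C C"
    then have A: "pl_edges A" "pl_edges B" "pl_edges C" by (simp_all add: label_iso_def)
    define r where "r k = (if even k then k else 2 * k - 1)" for k :: nat
    have r: "r (2 * k) = 2 * k" "r (2 * k + 1) = 2 * (2 * k) + 1" for k
      by (auto simp: r_def)
    have injr: "inj r"
    proof (rule injI)
      fix x y assume eq: "r x = r y"
      obtain i where i: "x = 2 * i \<or> x = 2 * i + 1" by (metis evenE oddE)
      obtain j where j: "y = 2 * j \<or> y = 2 * j + 1" by (metis evenE oddE)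
      have "2 * i \<noteq> 2 * (2 * j) + 1" "2 * (2 * i) + 1 \<noteq> 2 * j" by presburger+
      then show "x = y" using i j eq r by auto
    qed
    have r3: "r k \<noteq> 2 * (2 * m + 1) + 1" for k m
    proof -
      obtain i where i: "k = 2 * i \<or> k = 2 * i + 1" by (metis evenE oddE)
      have "2 * i \<noteq> 2 * (2 * m + 1) + 1" "2 * (2 * i) + 1 \<noteq> 2 * (2 * m + 1) + 1"
        by presburger+
      then show ?thesis using i r by auto
    qed
    have "label_iso (glue (glue A B) C) ((`) (rename r) ` glue A B \<union> (`) (?g \<circ> ?g) ` C)"
    proof (rule label_iso_glue)
      show "pl_edges (glue A B)" using A pl_edges_glue by blast
      show "inj_on (rename r) (\<Union>(glue A B))" using inj_rename[OF injr] inj_on_subset by blast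
      show "inj_on (?g \<circ> ?g) (\<Union>C)" using inj inj_compose inj_on_subset by blast
      show "label u \<noteq> None" if "rename r u = (?g \<circ> ?g) v" for u v
        using that r3 by (cases u; cases v) auto
    qed (use A in auto)
    moreover have "rename r (?f v) = ?f v" "rename r (?g v) = ?g (?f v)" for v
      using r by (cases v, auto)+
    ultimately show "label_iso (glue (glue A B) C) (glue A (glue B C))"
      by (simp add: glue_def image_Un image_image image_comp Un_assoc)
  qed
qed

end

type_synonym graph_comb = "plgraph \<Rightarrow>\<^sub>0 real"

definition unlabeled_combs :: "graph_comb set" where
  "unlabeled_combs = {a. \<forall>H \<in> Poly_Mapping.keys a. unlabeled H}"

definition unlabel_comb :: "graph_comb \<Rightarrow> graph_comb" where
  "unlabel_comb a =
     (\<Sum>H \<in> Poly_Mapping.keys a. Poly_Mapping.single (unlabel H) (Poly_Mapping.lookup a H))"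

definition homogeneous :: "nat \<Rightarrow> graph_comb \<Rightarrow> bool" where
  "homogeneous d a \<longleftrightarrow> (\<forall>H \<in> Poly_Mapping.keys a. deg H = d)"

definition sos_expression :: "graph_comb \<Rightarrow> graph_comb list \<Rightarrow> bool" where
  "sos_expression f as \<longleftrightarrow> f = (\<Sum>a\<leftarrow>as. unlabel_comb (a\<^sup>2))"

definition sos :: "graph_comb \<Rightarrow> bool" where
  "sos f \<longleftrightarrow> f \<in> unlabeled_combs \<and> (\<exists>as. sos_expression f as)"

end

theory Submission
  imports Defs "HOL-Library.FuncSet"
begin

text \<open>
  Let \<open>m\<close> be the least degree of \<open>H\<^sup>2\<close> over all constituent graphs \<open>H\<close> of the \<open>a\<^sub>i\<close>.  The degree
  of \<open>HH'\<close> is at least the mean of the degrees of \<open>H\<^sup>2\<close> and \<open>H'\<^sup>2\<close>, with equality only if \<open>H\<close> and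
  \<open>H'\<close> have the same edges between labeled vertices.  Hence the degree \<open>m\<close> part of \<open>f\<close> is again a
  sum of squares: each \<open>a\<^sub>i\<close> is cut down to the terms with \<open>deg (H\<^sup>2) = m\<close> and split according to
  the edges between labeled vertices.  If \<open>m \<noteq> d\<close>, this sum of squares is zero.

  A vanishing sum of squares has only zero summands.  Averaging the homomorphism density of a
  partially labeled graph into a target over the placements of the labels gives the density of the
  unlabeled graph, so \<open>[[a\<^sup>2]]\<close> is mapped to the mean of the squared densities of \<open>a\<close>, and these
  densities are linearly independent for distinct partially labeled graphs.  This contradicts the
  choice of \<open>m\<close>.
\<close>

section \<open>Homomorphism densities\<close>

definition avg :: "'b set \<Rightarrow> 'a set \<Rightarrow> (('a \<Rightarrow> 'b) \<Rightarrow> real) \<Rightarrow> real" where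
  "avg W S g = (\<Sum>\<psi>\<in>S \<rightarrow>\<^sub>E W. g \<psi>) / real (card W) ^ card S"

lemma avg_cong: "(\<And>\<psi>. \<psi> \<in> S \<rightarrow>\<^sub>E W \<Longrightarrow> f \<psi> = g \<psi>) \<Longrightarrow> avg W S f = avg W S g"
  by (simp add: avg_def cong: sum.cong)

lemma avg_sum: "avg W S (\<lambda>\<psi>. \<Sum>i\<in>I. f i \<psi>) = (\<Sum>i\<in>I. avg W S (f i))"
  unfolding avg_def by (subst sum.swap) (simp add: sum_divide_distrib)

lemma avg_cmult: "avg W S (\<lambda>\<psi>. c * f \<psi>) = c * avg W S f"
  by (simp add: avg_def sum_distrib_left)

lemma avg_const:
  assumes "finite S" "finite W" "W \<noteq> {}"
  shows "avg W S (\<lambda>\<psi>. c) = c"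
  using assms by (simp add: avg_def card_PiE)

lemma avg_nonneg: "(\<And>\<psi>. 0 \<le> f \<psi>) \<Longrightarrow> 0 \<le> avg W S f"
  by (simp add: avg_def sum_nonneg)

lemma avg_pos:
  assumes "finite S" "finite W" "\<And>\<psi>. 0 \<le> f \<psi>" "\<psi> \<in> S \<rightarrow>\<^sub>E W" "0 < f \<psi>"
  shows "0 < avg W S f"
proof -
  have "0 < sum f (S \<rightarrow>\<^sub>E W)"
    using assms by (intro sum_pos2[of _ \<psi>]) (auto intro: finite_PiE)
  \<comment> \<open>A nonempty \<open>S\<close> makes \<open>W\<close> nonempty, as
    \<open>\<psi>\<close> takes a value there; for empty \<open>S\<close> the power is 1.\<close>
  moreover have "0 < real (card W) ^ card S"
    using assms(1,2,4) by (cases "S = {}") (auto simp: card_gt_0_iff)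
  ultimately show ?thesis
    by (simp add: avg_def)
qed

text \<open>Fubini: restriction to \<open>A\<close> and \<open>B\<close> turns a map on the disjoint
  union into an independent pair of maps.\<close>

lemma avg_Un:
  assumes "finite A" "finite B" "A \<inter> B = {}"
  shows "avg W (A \<union> B) f = avg W A (\<lambda>x. avg W B (\<lambda>y. f (\<lambda>v. if v \<in> A then x v else y v)))"
proof -
  have "(\<Sum>\<psi>\<in>A \<union> B \<rightarrow>\<^sub>E W. f \<psi>) =
    (\<Sum>(x, y)\<in>(A \<rightarrow>\<^sub>E W) \<times> (B \<rightarrow>\<^sub>E W). f (\<lambda>v. if v \<in> A then x v else y v))"
  proof (rule sum.reindex_bij_witness[of _ "\<lambda>(x, y) v. if v \<in> A then x v else y v"
        "\<lambda>\<psi>. (restrict \<psi> A, restrict \<psi> B)"])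
    fix \<psi> assume psi: "\<psi> \<in> A \<union> B \<rightarrow>\<^sub>E W"
    have *: "(\<lambda>v. if v \<in> A then restrict \<psi> A v else restrict \<psi> B v) = \<psi>"
      using psi by (auto simp: fun_eq_iff PiE_def extensional_def)
    then show "(case (restrict \<psi> A, restrict \<psi> B) of (x, y) \<Rightarrow> \<lambda>v. if v \<in> A then x v else y v) = \<psi>"
      by simp
    show "(restrict \<psi> A, restrict \<psi> B) \<in> (A \<rightarrow>\<^sub>E W) \<times> (B \<rightarrow>\<^sub>E W)"
      using psi by (auto simp: PiE_iff)
    show "(case (restrict \<psi> A, restrict \<psi> B) of (x, y) \<Rightarrow> f (\<lambda>v. if v \<in> A then x v else y v)) = f \<psi>"
      using * by simp
  next
    fix p assume "p \<in> (A \<rightarrow>\<^sub>E W) \<times> (B \<rightarrow>\<^sub>E W)"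
    then obtain x y where p: "p = (x, y)" "x \<in> A \<rightarrow>\<^sub>E W" "y \<in> B \<rightarrow>\<^sub>E W" by blast
    show "(case p of (x, y) \<Rightarrow> \<lambda>v. if v \<in> A then x v else y v) \<in> A \<union> B \<rightarrow>\<^sub>E W"
      using p by (auto simp: PiE_iff extensional_def)
    show "(restrict (case p of (x, y) \<Rightarrow> \<lambda>v. if v \<in> A then x v else y v) A,
       restrict (case p of (x, y) \<Rightarrow> \<lambda>v. if v \<in> A then x v else y v) B) = p"
      using p assms(3) by (auto simp: PiE_iff extensional_def restrict_def fun_eq_iff)
  qed
  then show ?thesis
    using assms
    by (simp add: avg_def card_Un_disjoint power_add sum.cartesian_product flip: sum_divide_distrib)
qed

text \<open>Split \<open>S\<close> into \<open>A\<close> and \<open>S - A\<close>; the inner average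
  over the second block is that of a constant.\<close>

lemma avg_extend:
  assumes "finite S" "A \<subseteq> S" "finite W" "W \<noteq> {}"
    and dep: "\<And>x y. (\<And>v. v \<in> A \<Longrightarrow> x v = y v) \<Longrightarrow> f x = f y"
  shows "avg W S f = avg W A f"
proof -
  have "avg W S f = avg W (A \<union> (S - A)) f"
    using assms(2) by (simp add: Un_absorb1)
  also have "\<dots> = avg W A (\<lambda>x. avg W (S - A) (\<lambda>y. f x))"
    using assms(1,2) by (subst avg_Un) (auto intro!: avg_cong dep intro: finite_subset)
  finally show ?thesis
    using assms(1,3,4) by (simp add: avg_const)
qed

lemma avg_reindex:
  assumes bij: "bij_betw \<theta> A B"
    and eq: "\<And>\<psi>. \<psi> \<in> B \<rightarrow>\<^sub>E W \<Longrightarrow> g \<psi> = f (restrict (\<psi> \<circ> \<theta>) A)"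
  shows "avg W B g = avg W A f"
proof -
  let ?i = "inv_into A \<theta>"
  have i: "?i v \<in> A" "\<theta> (?i v) = v" if "v \<in> B" for v
    using that bij by (auto simp: bij_betw_def inv_into_into f_inv_into_f)
  have i': "\<theta> v \<in> B" "?i (\<theta> v) = v" if "v \<in> A" for v
    using that bij by (auto simp: bij_betw_def)
  have "(\<Sum>\<psi>\<in>B \<rightarrow>\<^sub>E W. g \<psi>) = (\<Sum>\<psi>\<in>A \<rightarrow>\<^sub>E W. f \<psi>)"
    by (rule sum.reindex_bij_witness[of _ "\<lambda>\<psi>. restrict (\<psi> \<circ> ?i) B" "\<lambda>\<psi>. restrict (\<psi> \<circ> \<theta>) A"])
      (auto simp: PiE_iff extensional_def restrict_def fun_eq_iff i i' eq)
  then show ?thesis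
    using bij by (simp add: avg_def bij_betw_same_card)
qed

lemma label_pres_labeled: "label w = label v \<Longrightarrow> label v \<noteq> None \<Longrightarrow> w = v"
  by (cases v; cases w) auto

section \<open>Densities with prescribed positions of the labels\<close>

definition unls :: "edges \<Rightarrow> vertex set" where
  "unls E = {v \<in> \<Union>E. label v = None}"

definition place :: "(vertex \<Rightarrow> 'b) \<Rightarrow> (vertex \<Rightarrow> 'b) \<Rightarrow> vertex \<Rightarrow> 'b" where
  "place \<phi> \<psi> v = (if label v = None then \<psi> v else \<phi> v)"

text \<open>The rooted homomorphism density into the target with vertices \<open>W\<close> and edges
  \<open>G\<close>: \<open>\<phi>\<close> pins the labeled vertices, the unlabeled ones are placed
  at random.\<close>

definition hom_dens :: "'b set \<Rightarrow> 'b set set \<Rightarrow> (vertex \<Rightarrow> 'b) \<Rightarrow> edges \<Rightarrow> real" where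
  "hom_dens W G \<phi> E = avg W (unls E) (\<lambda>\<psi>. of_bool (\<forall>e\<in>E. place \<phi> \<psi> ` e \<in> G))"

text \<open>An infinite edge would have \<open>card\<close> 0 instead of 2.\<close>

lemma finite_Union_pl_edges: "pl_edges E \<Longrightarrow> finite (\<Union>E)"
  unfolding pl_edges_def by (metis card.infinite finite_Union zero_neq_numeral)

lemma finite_unls: "pl_edges E \<Longrightarrow> finite (unls E)"
  by (rule finite_subset[OF _ finite_Union_pl_edges[of E]]) (auto simp: unls_def)

lemma unls_image:
  assumes "\<And>v. v \<in> \<Union>E \<Longrightarrow> label (\<theta> v) = label v"
  shows "unls ((`) \<theta> ` E) = \<theta> ` unls E"
  using assms unfolding unls_def by force

text \<open>An isomorphism fixes the labeled vertices and matches the unlabeled ones, so it is a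
  change of variables. Hence the density passes to the quotient type.\<close>

lemma label_iso_hom_dens:
  assumes "label_iso E E'"
  shows "hom_dens W G \<phi> E = hom_dens W G \<phi> E'"
proof -
  obtain \<theta> where \<theta>: "inj_on \<theta> (\<Union>E)" "\<And>v. v \<in> \<Union>E \<Longrightarrow> label (\<theta> v) = label v"
    "E' = (`) \<theta> ` E" using assms by (rule label_isoE) blast
  have fixl: "\<theta> v = v" if "v \<in> \<Union>E" "label v \<noteq> None" for v
    using \<theta>(2)[OF that(1)] that(2) by (rule label_pres_labeled)
  have unls: "unls E' = \<theta> ` unls E"
    unfolding \<theta>(3) using \<theta>(2) by (rule unls_image)
  have "inj_on \<theta> (unls E)"
    using \<theta>(1) by (rule inj_on_subset) (auto simp: unls_def)
  then have bij: "bij_betw \<theta> (unls E) (unls E')"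
    by (simp add: unls bij_betw_def)
  have "hom_dens W G \<phi> E' = hom_dens W G \<phi> E"
    unfolding hom_dens_def
  proof (rule avg_reindex[OF bij])
    fix \<psi>
    have "place \<phi> \<psi> ` \<theta> ` e = place \<phi> (restrict (\<psi> \<circ> \<theta>) (unls E)) ` e" if "e \<in> E" for e
    proof -
      have "place \<phi> \<psi> (\<theta> v) = place \<phi> (restrict (\<psi> \<circ> \<theta>) (unls E)) v" if "v \<in> e" for v
        using that \<open>e \<in> E\<close> \<theta>(2)[of v] fixl[of v] by (auto simp: place_def unls_def)
      then show ?thesis by (auto simp: image_image cong: image_cong)
    qed
    then show "of_bool (\<forall>e\<in>E'. place \<phi> \<psi> ` e \<in> G) =
      (of_bool (\<forall>e\<in>E. place \<phi> (restrict (\<psi> \<circ> \<theta>) (unls E)) ` e \<in> G) :: real)"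
      by (simp add: \<theta>(3))
  qed
  then show ?thesis ..
qed

lemma place_cong:
  "\<lbrakk>\<And>v. v \<in> e \<Longrightarrow> label v = None \<Longrightarrow> \<psi> v = \<psi>' v; \<And>v. v \<in> e \<Longrightarrow> label v \<noteq> None \<Longrightarrow> \<phi> v = \<phi>' v\<rbrakk>
    \<Longrightarrow> place \<phi> \<psi> ` e = place \<phi>' \<psi>' ` e"
  by (auto simp: place_def intro!: image_cong)

text \<open>The indicator is a product, and its two factors depend on disjoint sets of random
  vertices. Shared labeled vertices cause no dependence, since \<open>\<phi>\<close> is
  fixed.\<close>

lemma hom_dens_Un:
  assumes "pl_edges A" "pl_edges B" and disj: "unls A \<inter> unls B = {}"
  shows "hom_dens W G \<phi> (A \<union> B) = hom_dens W G \<phi> A * hom_dens W G \<phi> B"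
proof -
  have U: "unls (A \<union> B) = unls A \<union> unls B" by (auto simp: unls_def)
  have "(of_bool (\<forall>e\<in>A \<union> B. place \<phi> (\<lambda>v. if v \<in> unls A then x v else y v) ` e \<in> G) :: real) =
    of_bool (\<forall>e\<in>A. place \<phi> x ` e \<in> G) * of_bool (\<forall>e\<in>B. place \<phi> y ` e \<in> G)" for x y
  proof -
    have "place \<phi> (\<lambda>v. if v \<in> unls A then x v else y v) ` e = place \<phi> x ` e" if "e \<in> A" for e
      using that by (intro place_cong) (auto simp: unls_def)
    moreover have "place \<phi> (\<lambda>v. if v \<in> unls A then x v else y v) ` e = place \<phi> y ` e" if "e \<in> B" for e
    proof (intro place_cong)
      fix v assume "v \<in> e" "label v = None"
      then have "v \<in> unls B" using that by (auto simp: unls_def)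
      then show "(if v \<in> unls A then x v else y v) = y v" using disj by auto
    qed simp
    ultimately show ?thesis by (simp add: ball_Un of_bool_conj)
  qed
  then show ?thesis
    unfolding hom_dens_def U using assms
    by (simp add: avg_Un finite_unls avg_cmult mult.commute[of _ "avg W (unls B) _"])
qed

text \<open>The renamings in \<open>glue\<close> separate the unlabeled vertices by parity, which
  reduces the claim to the disjoint case.\<close>

lemma hom_dens_glue:
  assumes "pl_edges A" "pl_edges B"
  shows "hom_dens W G \<phi> (glue A B) = hom_dens W G \<phi> A * hom_dens W G \<phi> B"
proof -
  let ?f = "rename (\<lambda>k. 2 * k)" and ?g = "rename (\<lambda>k. 2 * k + 1)"
  have inj: "inj ?f" "inj ?g" by (intro inj_rename inj_double)+
  have iso: "label_iso A ((`) ?f ` A)" "label_iso B ((`) ?g ` B)"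
    using assms inj inj_on_subset by (auto intro!: label_iso_image)
  have "unls ((`) ?f ` A) \<inter> unls ((`) ?g ` B) = {}"
  proof -
    have "False" if "u \<in> unls A" "?f u = ?g v" for u v
      using that rename_parity[of u v] by (simp add: unls_def)
    then show ?thesis by (auto simp: unls_image)
  qed
  moreover have "pl_edges ((`) ?f ` A)" "pl_edges ((`) ?g ` B)"
    using iso by (auto simp: label_iso_def)
  ultimately have "hom_dens W G \<phi> (glue A B) =
      hom_dens W G \<phi> ((`) ?f ` A) * hom_dens W G \<phi> ((`) ?g ` B)"
    unfolding glue_def by (intro hom_dens_Un)
  also have "\<dots> = hom_dens W G \<phi> A * hom_dens W G \<phi> B"
    by (simp only: iso[THEN label_iso_hom_dens, symmetric])
  finally show ?thesis .
qed

text \<open>Random labels followed by random unlabeled vertices place all vertices at random. After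
  unlabeling no vertex is pinned, whence \<open>\<phi>0\<close> is arbitrary.\<close>

lemma avg_hom_dens:
  assumes E: "pl_edges E" and W: "finite W" "W \<noteq> {}"
    and L: "finite L" "{v \<in> \<Union>E. label v \<noteq> None} \<subseteq> L" "\<And>v. v \<in> L \<Longrightarrow> label v \<noteq> None"
  shows "avg W L (\<lambda>\<phi>. hom_dens W G \<phi> E) = hom_dens W G \<phi>0 ((`) unlabel_vertex ` E)"
proof -
  let ?u = unlabel_vertex
  let ?ind = "\<lambda>\<psi>. of_bool (\<forall>e\<in>E. \<psi> ` e \<in> G) :: real"
  have disj: "L \<inter> unls E = {}" using L(3) unfolding unls_def by blast
  have inL: "v \<in> L \<longleftrightarrow> label v \<noteq> None" if "v \<in> \<Union>E" for v
    using that L(2,3) by blast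
  have "place x y ` e = (\<lambda>v. if v \<in> L then x v else y v) ` e" if "e \<in> E" for x y :: "vertex \<Rightarrow> 'a" and e
  proof (rule image_cong)
    fix v assume "v \<in> e"
    then have "v \<in> L \<longleftrightarrow> label v \<noteq> None" using that inL by blast
    then show "place x y v = (if v \<in> L then x v else y v)" by (simp add: place_def)
  qed simp
  then have "avg W L (\<lambda>\<phi>. hom_dens W G \<phi> E) =
      avg W L (\<lambda>x. avg W (unls E) (\<lambda>y. ?ind (\<lambda>v. if v \<in> L then x v else y v)))"
    by (simp add: hom_dens_def)
  also have "\<dots> = avg W (L \<union> unls E) ?ind"
    using disj L(1) E by (simp add: avg_Un finite_unls)
  \<comment> \<open>Elements of \<open>L\<close> that are not vertices of \<open>E\<close> are
    averaged out.\<close>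
  also have "\<dots> = avg W (\<Union>E) ?ind"
  proof (rule avg_extend)
    show "\<Union>E \<subseteq> L \<union> unls E" using L(2) unfolding unls_def by blast
    fix x y :: "vertex \<Rightarrow> 'a" assume "\<And>v. v \<in> \<Union>E \<Longrightarrow> x v = y v"
    then have "x ` e = y ` e" if "e \<in> E" for e using that by (intro image_cong) auto
    then show "?ind x = ?ind y" by simp
  qed (use L W E finite_unls in auto)
  also have "\<dots> = hom_dens W G \<phi>0 ((`) ?u ` E)"
    unfolding hom_dens_def
  proof (rule avg_reindex[symmetric])
    show "bij_betw ?u (\<Union>E) (unls ((`) ?u ` E))"
      using inj_unlabel_vertex by (auto simp: bij_betw_def unls_def intro: inj_on_subset)
    fix \<psi> :: "vertex \<Rightarrow> 'a"
    have "place \<phi>0 \<psi> ` ?u ` e = restrict (\<psi> \<circ> ?u) (\<Union>E) ` e" if "e \<in> E" for e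
      unfolding image_image using that by (intro image_cong) (auto simp: place_def)
    then show "of_bool (\<forall>e\<in>(`) ?u ` E. place \<phi>0 \<psi> ` e \<in> G) = ?ind (restrict (\<psi> \<circ> ?u) (\<Union>E))"
      by simp
  qed
  finally show ?thesis .
qed

section \<open>Labels and degrees\<close>

text \<open>Used where a map fixes the labeled vertices, or the edges between them: this makes
  \<open>labs\<close> and \<open>core\<close> independent of the representative.\<close>

lemma Collect_image_fixed:
  assumes "\<And>v. v \<in> S \<Longrightarrow> P (f v) \<longleftrightarrow> P v" "\<And>v. v \<in> S \<Longrightarrow> P v \<Longrightarrow> f v = v"
  shows "{v \<in> f ` S. P v} = {v \<in> S. P v}"
  using assms by force

lift_definition labs :: "plgraph \<Rightarrow> vertex set" is "\<lambda>E. {v \<in> \<Union>E. label v \<noteq> None}"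
proof (erule label_isoE)
  fix A B :: edges and \<phi>
  assume *: "\<And>v. v \<in> \<Union>A \<Longrightarrow> label (\<phi> v) = label v" "B = (`) \<phi> ` A"
  have fixed: "\<phi> v = v" if "v \<in> \<Union>A" "label v \<noteq> None" for v
    using *(1)[OF that(1)] that(2) by (rule label_pres_labeled)
  have V: "\<Union>B = \<phi> ` \<Union>A" using *(2) by blast
  show "{v \<in> \<Union>A. label v \<noteq> None} = {v \<in> \<Union>B. label v \<noteq> None}"
    unfolding V by (rule Collect_image_fixed[symmetric]) (simp only: *(1), rule fixed)
qed

text \<open>Edges between labeled vertices are the only ones that gluing can merge; isomorphisms fix
  them, so they are recorded literally.\<close>

lift_definition core :: "plgraph \<Rightarrow> edges" is "\<lambda>E. {e \<in> E. \<forall>v\<in>e. label v \<noteq> None}"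
proof (erule label_isoE)
  fix A B :: edges and \<phi>
  assume *: "\<And>v. v \<in> \<Union>A \<Longrightarrow> label (\<phi> v) = label v" "B = (`) \<phi> ` A"
  have fixed: "\<phi> ` e = e" if "e \<in> A" "\<forall>v\<in>e. label v \<noteq> None" for e
  proof -
    have "\<phi> v = v" if "v \<in> e" for v
      using that \<open>e \<in> A\<close> \<open>\<forall>v\<in>e. label v \<noteq> None\<close> * by (intro label_pres_labeled) blast+
    then show ?thesis by simp
  qed
  have lab: "(\<forall>v\<in>\<phi> ` e. label v \<noteq> None) \<longleftrightarrow> (\<forall>v\<in>e. label v \<noteq> None)" if "e \<in> A" for e
  proof -
    have "label (\<phi> v) = label v" if "v \<in> e" for v using that \<open>e \<in> A\<close> * by blast
    then show ?thesis by simp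
  qed
  show "{e \<in> A. \<forall>v\<in>e. label v \<noteq> None} = {e \<in> B. \<forall>v\<in>e. label v \<noteq> None}"
    unfolding *(2) by (rule Collect_image_fixed[symmetric]) (simp only: lab, rule fixed)
qed

lemma rename_eq_imp_labeled:
  assumes "rename (\<lambda>k. 2 * k) ` a = rename (\<lambda>k. 2 * k + 1) ` b" "v \<in> a \<union> b"
  shows "label v \<noteq> None"
proof -
  obtain x y where xy: "x \<in> a" "y \<in> b" "rename (\<lambda>k. 2 * k) x = rename (\<lambda>k. 2 * k + 1) y" "v = x \<or> v = y"
    using assms by (metis (no_types, lifting) Un_iff imageE imageI)
  have "label x \<noteq> None" using rename_parity[OF xy(3)] .
  moreover have "label x = label y" using xy(3) by (metis label_rename)
  ultimately show ?thesis using xy(4) by metis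
qed

lemma rename_labeled: "label v \<noteq> None \<Longrightarrow> rename g v = v"
  by (cases v) auto

text \<open>Inclusion-exclusion: an edge is doubled exactly when it lies in both cores. The additive
  form avoids subtraction of naturals.\<close>

lemma deg_plus: "deg (H + H') + card (core H \<inter> core H') = deg H + deg H'"
proof transfer
  fix A B :: edges assume "label_iso A A" "label_iso B B"
  then have fin: "finite A" "finite B" by (simp_all add: label_iso_def pl_edges_def)
  let ?f = "rename (\<lambda>k. 2 * k)" and ?g = "rename (\<lambda>k. 2 * k + 1)"
  let ?core = "\<lambda>E. {e \<in> E. \<forall>v\<in>e. label v \<noteq> None}"
  have "inj ?f" "inj ?g" by (intro inj_rename inj_double)+
  then have inj: "inj_on ((`) ?f) A" "inj_on ((`) ?g) B"
    by (meson inj_on_image inj_on_subset subset_UNIV)+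
  have fixed: "rename h ` e = e" if "\<forall>v\<in>e. label v \<noteq> None" for e h
    using that by (simp add: rename_labeled)
  have "(`) ?f ` A \<inter> (`) ?g ` B = ?core A \<inter> ?core B"
  proof (intro equalityI subsetI)
    fix e assume "e \<in> (`) ?f ` A \<inter> (`) ?g ` B"
    then obtain a b where ab: "a \<in> A" "b \<in> B" "e = ?f ` a" "e = ?g ` b" by blast
    then have "\<forall>v\<in>a. label v \<noteq> None" "\<forall>v\<in>b. label v \<noteq> None"
      using rename_eq_imp_labeled[of a b] by blast+
    moreover from this have "a = e" "b = e" using ab(3,4) fixed by simp_all
    ultimately show "e \<in> ?core A \<inter> ?core B" using ab(1,2) by blast
  next
    fix e assume "e \<in> ?core A \<inter> ?core B"
    then have e: "e \<in> A" "e \<in> B" "\<forall>v\<in>e. label v \<noteq> None" by blast+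
    have "e = ?f ` e" "e = ?g ` e" by (intro fixed[OF e(3), symmetric])+
    with e show "e \<in> (`) ?f ` A \<inter> (`) ?g ` B" by blast
  qed
  moreover have "card ((`) ?f ` A) = card A" "card ((`) ?g ` B) = card B"
    by (intro card_image inj)+
  ultimately show "card (glue A B) + card (?core A \<inter> ?core B) = card A + card B"
    using card_Un_Int[of "(`) ?f ` A" "(`) ?g ` B"] fin
    by (simp only: glue_def finite_imageI)
qed

lemma finite_core: "finite (core H)"
  by transfer (auto simp: label_iso_def pl_edges_def)

text \<open>Twice \<open>deg (H + H')\<close> exceeds \<open>deg (H + H) + deg (H' + H')\<close> by
  the size of the symmetric difference of the two cores.\<close>

lemma deg_plus_eq_iff:
  assumes "m \<le> deg (H + H)" "m \<le> deg (H' + H')"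
  shows "deg (H + H') = m \<longleftrightarrow> deg (H + H) = m \<and> deg (H' + H') = m \<and> core H = core H'"
proof -
  let ?i = "card (core H \<inter> core H')"
  have le: "?i \<le> card (core H)" "?i \<le> card (core H')"
    by (auto intro: card_mono finite_core)
  have eqs: "deg (H + H) + card (core H) = 2 * deg H" "deg (H' + H') + card (core H') = 2 * deg H'"
    "deg (H + H') + ?i = deg H + deg H'"
    using deg_plus[of H H] deg_plus[of H' H'] deg_plus[of H H'] by simp_all
  show ?thesis
  proof
    assume m: "deg (H + H') = m"
    then have "?i = card (core H)" "?i = card (core H')" "deg (H + H) = m" "deg (H' + H') = m"
      using le eqs assms by linarith+
    moreover from this have "core H \<inter> core H' = core H" "core H \<inter> core H' = core H'"
      by (simp_all add: card_subset_eq finite_core)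
    ultimately show "deg (H + H) = m \<and> deg (H' + H') = m \<and> core H = core H'" by auto
  qed (use eqs in auto)
qed

lemma deg_unlabel [simp]: "deg (unlabel H) = deg H"
proof transfer
  fix A :: edges
  have "inj_on ((`) unlabel_vertex) A"
    using inj_unlabel_vertex by (meson inj_on_image inj_on_subset subset_UNIV)
  then show "card ((`) unlabel_vertex ` A) = card A"
    by (rule card_image)
qed

section \<open>Positivity of sums of squares\<close>

lift_definition tdens :: "'b set \<Rightarrow> 'b set set \<Rightarrow> (vertex \<Rightarrow> 'b) \<Rightarrow> plgraph \<Rightarrow> real" is hom_dens
  by (rule label_iso_hom_dens)

lemma tdens_plus: "tdens W G \<phi> (H + H') = tdens W G \<phi> H * tdens W G \<phi> H'"
  by transfer (simp add: hom_dens_glue label_iso_def)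

lemma finite_labs: "finite (labs H)"
proof transfer
  fix E assume "label_iso E E"
  then have "finite (\<Union>E)" by (simp only: label_iso_def finite_Union_pl_edges)
  then show "finite {v \<in> \<Union>E. label v \<noteq> None}" by (rule rev_finite_subset) blast
qed

lemma labs_labeled: "v \<in> labs H \<Longrightarrow> label v \<noteq> None"
  by transfer blast

lemma labs_plus: "labs (H + H') = labs H \<union> labs H'"
proof transfer
  fix A B :: edges
  let ?f = "rename (\<lambda>k. 2 * k)" and ?g = "rename (\<lambda>k. 2 * k + 1)"
  let ?L = "\<lambda>E. {v \<in> \<Union>E. label v \<noteq> None}"
  have *: "?L ((`) (rename h) ` A) = ?L A" for h A
    unfolding image_Union[symmetric]
    by (rule Collect_image_fixed) (simp only: label_rename, rule rename_labeled)
  have "?L (P \<union> Q) = ?L P \<union> ?L Q" for P Q by blast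
  then show "?L (glue A B) = ?L A \<union> ?L B"
    by (simp only: glue_def *)
qed

lemma avg_tdens:
  assumes "finite W" "W \<noteq> {}" "finite L" "labs H \<subseteq> L" "\<And>v. v \<in> L \<Longrightarrow> label v \<noteq> None"
  shows "avg W L (\<lambda>\<phi>. tdens W G \<phi> H) = tdens W G \<phi>0 (unlabel H)"
  using assms(4)
proof (transfer fixing: W G L \<phi>0)
  fix E assume "label_iso E E" "{v \<in> \<Union>E. label v \<noteq> None} \<subseteq> L"
  then show "avg W L (\<lambda>\<phi>. hom_dens W G \<phi> E) = hom_dens W G \<phi>0 ((`) unlabel_vertex ` E)"
    using assms by (intro avg_hom_dens) (auto simp: label_iso_def)
qed

section \<open>Evaluation of graph combinations in a target\<close>

definition eval_comb :: "'b set \<Rightarrow> 'b set set \<Rightarrow> (vertex \<Rightarrow> 'b) \<Rightarrow> graph_comb \<Rightarrow> real" where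
  "eval_comb W G \<phi> a = (\<Sum>H\<in>Poly_Mapping.keys a. Poly_Mapping.lookup a H * tdens W G \<phi> H)"

lemma sum_single_lookup:
  assumes "finite K" "Poly_Mapping.keys a \<subseteq> K"
  shows "(\<Sum>H\<in>K. Poly_Mapping.single H (Poly_Mapping.lookup a H)) = a"
proof (rule poly_mapping_eqI)
  fix H
  show "Poly_Mapping.lookup (\<Sum>H\<in>K. Poly_Mapping.single H (Poly_Mapping.lookup a H)) H =
    Poly_Mapping.lookup a H"
    using assms by (auto simp: lookup_sum lookup_single when_def in_keys_iff)
qed

lemma additive_eval_comb: "additive (eval_comb W G \<phi>)"
  unfolding additive_def eval_comb_def
  by (intro allI setsum_keys_plus_distrib) (simp_all add: distrib_right)

lemma eval_comb_single: "eval_comb W G \<phi> (Poly_Mapping.single H c) = c * tdens W G \<phi> H"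
  by (simp add: eval_comb_def)

lemma additive_unlabel_comb: "additive unlabel_comb"
  unfolding additive_def unlabel_comb_def
  by (intro allI setsum_keys_plus_distrib) (simp_all add: single_add)

lemma unlabel_comb_single:
  "unlabel_comb (Poly_Mapping.single H c) = Poly_Mapping.single (unlabel H) c"
  by (simp add: unlabel_comb_def)

lemma eval_comb_mult: "eval_comb W G \<phi> (a * b) = eval_comb W G \<phi> a * eval_comb W G \<phi> b"
proof -
  let ?s = "\<lambda>a H. Poly_Mapping.single H (Poly_Mapping.lookup a H)"
  have "a * b = (\<Sum>H\<in>Poly_Mapping.keys a. ?s a H) * (\<Sum>H\<in>Poly_Mapping.keys b. ?s b H)"
    by (simp add: sum_single_lookup)
  also have "eval_comb W G \<phi> \<dots> = eval_comb W G \<phi> a * eval_comb W G \<phi> b"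
    unfolding sum_product mult_single additive.sum[OF additive_eval_comb] eval_comb_single tdens_plus
    by (simp add: eval_comb_def sum_product mult_ac)
  finally show ?thesis .
qed

text \<open>Forgetting labels becomes averaging over their positions, so an unlabeled square becomes
  a mean of squares.\<close>

lemma avg_eval_comb:
  assumes "finite W" "W \<noteq> {}" "finite L" "\<And>v. v \<in> L \<Longrightarrow> label v \<noteq> None"
    and "\<And>H. H \<in> Poly_Mapping.keys a \<Longrightarrow> labs H \<subseteq> L"
  shows "avg W L (\<lambda>\<phi>. eval_comb W G \<phi> a) = eval_comb W G \<phi>0 (unlabel_comb a)"
proof -
  have "avg W L (\<lambda>\<phi>. eval_comb W G \<phi> a) =
      (\<Sum>H\<in>Poly_Mapping.keys a. Poly_Mapping.lookup a H * tdens W G \<phi>0 (unlabel H))"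
    unfolding eval_comb_def avg_sum avg_cmult using assms by (intro sum.cong) (simp_all add: avg_tdens)
  also have "\<dots> = eval_comb W G \<phi>0 (unlabel_comb a)"
    by (simp add: unlabel_comb_def additive.sum[OF additive_eval_comb] eval_comb_single)
  finally show ?thesis .
qed

section \<open>Linear independence of densities\<close>

text \<open>Recovered from \<^const>\<open>hom_dens\<close> by Moebius inversion over the subgraphs of \<open>F\<close>.\<close>

definition im_dens :: "'b set \<Rightarrow> 'b set set \<Rightarrow> (vertex \<Rightarrow> 'b) \<Rightarrow> edges \<Rightarrow> real" where
  "im_dens W F \<phi> E = avg W (unls E) (\<lambda>\<psi>. of_bool ((`) (place \<phi> \<psi>) ` E = F))"

text \<open>Each placement has exactly one image edge set \<open>F\<close>, and it is a homomorphism
  iff \<open>F\<close> is contained in \<open>G\<close>.\<close>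

lemma hom_dens_eq_sum_im_dens:
  assumes "finite G"
  shows "hom_dens W G \<phi> E = (\<Sum>F\<in>Pow G. im_dens W F \<phi> E)"
proof -
  have "of_bool (\<forall>e\<in>E. place \<phi> \<psi> ` e \<in> G) =
      (\<Sum>F\<in>Pow G. of_bool ((`) (place \<phi> \<psi>) ` E = F) :: real)" for \<psi>
  proof -
    have "(\<Sum>F\<in>Pow G. of_bool ((`) (place \<phi> \<psi>) ` E = F) :: real) =
        of_bool ((`) (place \<phi> \<psi>) ` E \<in> Pow G)"
      using assms by (simp only: of_bool_def sum.delta' finite_Pow_iff)
    then show ?thesis by (simp add: image_subset_iff)
  qed
  then show ?thesis by (simp add: hom_dens_def im_dens_def avg_sum)
qed

lemma card_vertices:
  assumes "pl_edges E"
  shows "card (\<Union>E) = card (unls E) + card {v \<in> \<Union>E. label v \<noteq> None}"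
proof -
  have fin: "finite (\<Union>E)" using assms by (rule finite_Union_pl_edges)
  have split: "unls E \<union> {v \<in> \<Union>E. label v \<noteq> None} = \<Union>E" unfolding unls_def by blast
  moreover have "unls E \<inter> {v \<in> \<Union>E. label v \<noteq> None} = {}" unfolding unls_def by blast
  moreover have "finite {v \<in> \<Union>E. label v \<noteq> None}" using fin by (rule rev_finite_subset) blast
  ultimately show ?thesis
    using card_Un_disjoint[of "unls E" "{v \<in> \<Union>E. label v \<noteq> None}"] finite_unls[OF assms]
    by (simp only: split)
qed

text \<open>The size is twice the number of vertices minus the number of labels. A map fixing labels
  can lose vertices and gain labels, but not conversely, so the size cannot grow; equality leaves
  \<open>\<theta>\<close> injective and creates no label.\<close>

lemma label_iso_of_image_eq:
  assumes E: "pl_edges E" "pl_edges E'"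
    and fixed: "\<And>v. v \<in> \<Union>E \<Longrightarrow> label v \<noteq> None \<Longrightarrow> \<theta> v = v"
    and img: "(`) \<theta> ` E = E'"
    and size: "card (\<Union>E) + card (unls E) \<le> card (\<Union>E') + card (unls E')"
  shows "label_iso E E'"
proof -
  let ?L = "\<lambda>E. {v \<in> \<Union>E. label v \<noteq> None}"
  have V: "\<Union>E' = \<theta> ` \<Union>E" using img by blast
  have fin: "finite (\<Union>E)" "finite (\<Union>E')" using E by (simp_all only: finite_Union_pl_edges)
  have finL: "finite (?L E')" using fin(2) by (rule rev_finite_subset) blast
  have sub: "?L E \<subseteq> ?L E'"
  proof
    fix v assume v: "v \<in> ?L E"
    then have "\<theta> v = v" using fixed by blast
    moreover have "\<theta> v \<in> \<Union>E'" using v unfolding V by blast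
    ultimately show "v \<in> ?L E'" using v by simp
  qed
  have "card (?L E) \<le> card (?L E')" using finL sub by (rule card_mono)
  moreover have "card (\<Union>E') \<le> card (\<Union>E)" unfolding V using fin(1) by (rule card_image_le)
  ultimately have cL: "card (?L E) = card (?L E')" and cV: "card (\<Union>E') = card (\<Union>E)"
    using size card_vertices[OF E(1)] card_vertices[OF E(2)] by linarith+
  have L: "?L E = ?L E'" using finL sub cL by (rule card_subset_eq)
  have inj: "inj_on \<theta> (\<Union>E)" using cV unfolding V by (rule eq_card_imp_inj_on[OF fin(1)])
  have "label (\<theta> v) = label v" if v: "v \<in> \<Union>E" for v
  proof (cases "label v = None")
    case True
    \<comment> \<open>A label hit by an unlabeled \<open>v\<close> would already occur in
      \<open>E\<close> and be fixed by \<open>\<theta>\<close>, contradicting injectivity.\<close>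
    have "label (\<theta> v) = None"
    proof (rule ccontr)
      assume l: "label (\<theta> v) \<noteq> None"
      have "\<theta> v \<in> \<Union>E'" using v unfolding V by blast
      then have "\<theta> v \<in> ?L E" using l unfolding L by blast
      then have "\<theta> v \<in> \<Union>E" "\<theta> (\<theta> v) = \<theta> v" using fixed by blast+
      then have "\<theta> v = v" using inj v by (meson inj_onD)
      then show False using l True by simp
    qed
    then show ?thesis using True by simp
  qed (use fixed v in simp)
  then show ?thesis
    using label_iso_image[OF E(1) inj] img by simp
qed

lemma pl_edges_rep: "pl_edges (rep_plgraph H)"
  using Quotient_rep_reflp[OF Quotient_plgraph] by (simp add: label_iso_def)

lemma label_iso_rep_iff: "label_iso (rep_plgraph H) (rep_plgraph H') \<longleftrightarrow> H = H'"
  by (rule Quotient_rel_rep[OF Quotient_plgraph])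

lemma tdens_rep: "tdens W G \<phi> H = hom_dens W G \<phi> (rep_plgraph H)"
  by (simp add: tdens_def map_fun_def)

lemma labs_rep: "labs H = {v \<in> \<Union>(rep_plgraph H). label v \<noteq> None}"
  by (simp add: labs_def map_fun_def)

text \<open>If all evaluations vanished, so would the combinations \<open>c F\<close> of exact-image
  densities. At \<open>F = E0\<close>, a constituent of maximal size, only that constituent
  contributes, and it contributes a nonzero amount.\<close>

lemma eval_comb_nonzero:
  assumes a: "a \<noteq> 0" and L: "finite L" "\<And>H. H \<in> Poly_Mapping.keys a \<Longrightarrow> labs H \<subseteq> L"
  shows "\<exists>(W :: vertex set) G \<phi>. finite W \<and> W \<noteq> {} \<and> \<phi> \<in> L \<rightarrow>\<^sub>E W \<and> eval_comb W G \<phi> a \<noteq> 0"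
proof (rule ccontr)
  assume contr: "\<not> ?thesis"
  let ?K = "Poly_Mapping.keys a"
  \<comment> \<open>With this choice of \<open>H0\<close>, no other constituent graph maps onto \<open>H0\<close> with labels fixed.\<close>
  define size where "size H = card (\<Union>(rep_plgraph H)) + card (unls (rep_plgraph H))" for H
  have K: "finite ?K" "?K \<noteq> {}" using a by simp_all
  then have "Max (size ` ?K) \<in> size ` ?K" by simp
  then obtain H0 where H0: "H0 \<in> ?K" "size H0 = Max (size ` ?K)" by (metis imageE)
  then have size_le: "size H \<le> size H0" if "H \<in> ?K" for H using that K by simp
  define E0 where "E0 = rep_plgraph H0"
  have E0: "pl_edges E0" by (simp add: E0_def pl_edges_rep)
  \<comment> \<open>\<open>Lab 0\<close> keeps \<open>W\<close> nonempty even for an empty graph and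
    empty \<open>L\<close>.\<close>
  define W where "W = insert (Lab 0) (L \<union> \<Union>E0)"
  have W: "finite W" "W \<noteq> {}" using L(1) finite_Union_pl_edges[OF E0] by (simp_all add: W_def)
  \<comment> \<open>Every label sits at itself, so placements fix the labeled vertices of all
    constituent graphs.\<close>
  define \<phi> where "\<phi> = restrict id L"
  have \<phi>: "\<phi> \<in> L \<rightarrow>\<^sub>E W" by (simp add: \<phi>_def W_def)
  have place_fixed: "place \<phi> \<psi> v = v"
    if "H \<in> ?K" "v \<in> \<Union>(rep_plgraph H)" "label v \<noteq> None" for H v \<psi>
  proof -
    have "v \<in> L" using that L(2)[of H] unfolding labs_rep by blast
    then show ?thesis using that(3) by (auto simp: place_def \<phi>_def)
  qed
  have eval0: "eval_comb W G \<phi> a = 0" for G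
  proof (rule ccontr)
    assume "eval_comb W G \<phi> a \<noteq> 0"
    with W \<phi> have "finite W \<and> W \<noteq> {} \<and> \<phi> \<in> L \<rightarrow>\<^sub>E W \<and> eval_comb W G \<phi> a \<noteq> 0"
      by (intro conjI)
    with contr show False by (elim notE) (intro exI)
  qed
  define c where "c F = (\<Sum>H\<in>?K. Poly_Mapping.lookup a H * im_dens W F \<phi> (rep_plgraph H))" for F
  have sum_c: "(\<Sum>F\<in>Pow G. c F) = 0" if "finite G" for G
  proof -
    have "(\<Sum>F\<in>Pow G. c F) = eval_comb W G \<phi> a"
      unfolding c_def eval_comb_def tdens_rep hom_dens_eq_sum_im_dens[OF that]
      by (subst sum.swap) (simp add: sum_distrib_left)
    then show ?thesis by (simp only: eval0)
  qed
  \<comment> \<open>Moebius inversion by induction: the sum over all subsets of \<open>F\<close>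
    vanishes, and so do the terms of the proper subsets.\<close>
  have c0: "c F = 0" if "finite F" for F
    using that
  proof (induction F rule: finite_psubset_induct)
    case (psubset F)
    have "(\<Sum>F'\<in>Pow F - {F}. c F') = 0"
      using psubset by (intro sum.neutral) (auto simp: psubset_eq)
    then show ?case
      using sum_c[OF psubset.hyps(1)] psubset.hyps(1) by (simp add: sum.remove[of "Pow F" F])
  qed
  \<comment> \<open>A graph that is mapped onto \<open>E0\<close> would be isomorphic to it,
    \<open>H0\<close> having maximal size.\<close>
  have "im_dens W E0 \<phi> (rep_plgraph H) = 0" if H: "H \<in> ?K - {H0}" for H
  proof -
    have "(`) (place \<phi> \<psi>) ` rep_plgraph H \<noteq> E0" for \<psi>
    proof
      assume "(`) (place \<phi> \<psi>) ` rep_plgraph H = E0"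
      then have "label_iso (rep_plgraph H) E0"
        using H size_le[of H] place_fixed[of H] E0
        by (intro label_iso_of_image_eq[of _ _ "place \<phi> \<psi>"])
          (simp_all only: pl_edges_rep size_def E0_def Diff_iff)
      then show False using H by (simp add: E0_def label_iso_rep_iff)
    qed
    then show ?thesis by (simp add: im_dens_def avg_def)
  qed
  then have "c E0 = Poly_Mapping.lookup a H0 * im_dens W E0 \<phi> E0"
    unfolding c_def using H0(1) K(1) by (simp add: sum.remove[of ?K H0] E0_def)
  moreover have "0 < im_dens W E0 \<phi> E0"
    unfolding im_dens_def
  proof (rule avg_pos)
    show "restrict id (unls E0) \<in> unls E0 \<rightarrow>\<^sub>E W" by (auto simp: unls_def W_def)
    have "place \<phi> (restrict id (unls E0)) ` e = e" if "e \<in> E0" for e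
    proof -
      have "place \<phi> (restrict id (unls E0)) v = v" if "v \<in> e" for v
      proof (cases "label v = None")
        case True
        then show ?thesis using that \<open>e \<in> E0\<close> by (auto simp: place_def unls_def)
      next
        case False
        then show ?thesis
          using that \<open>e \<in> E0\<close> place_fixed[OF H0(1)] unfolding E0_def by blast
      qed
      then show ?thesis by simp
    qed
    then show "(0::real) < of_bool ((`) (place \<phi> (restrict id (unls E0))) ` E0 = E0)"
      by simp
  qed (use W E0 finite_unls in simp_all)
  moreover have "finite E0" using E0 by (simp add: pl_edges_def)
  ultimately show False using c0[of E0] H0(1) by (simp add: in_keys_iff)
qed

lemma eval_comb_sum_list: "eval_comb W G \<phi> (\<Sum>x\<leftarrow>xs. f x) = (\<Sum>x\<leftarrow>xs. eval_comb W G \<phi> (f x))"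
  by (induction xs) (simp_all add: additive.zero[OF additive_eval_comb] additive.add[OF additive_eval_comb])

text \<open>Choose a target and label positions at which \<open>a\<close> does not vanish. Every
  summand evaluates to a mean of squares, and that of \<open>a\<close> is strictly positive.\<close>

lemma sum_squares_eq_0:
  assumes "(\<Sum>a\<leftarrow>as. unlabel_comb (a\<^sup>2)) = 0" "a \<in> set as"
  shows "a = 0"
proof (rule ccontr)
  assume "a \<noteq> 0"
  define Ls where "Ls b = (\<Union>H\<in>Poly_Mapping.keys b. labs H)" for b :: graph_comb
  have Ls: "finite (Ls b)" "\<And>H. H \<in> Poly_Mapping.keys b \<Longrightarrow> labs H \<subseteq> Ls b"
    "\<And>v. v \<in> Ls b \<Longrightarrow> label v \<noteq> None" for b
    unfolding Ls_def using labs_labeled by (blast intro: finite_UN_I finite_keys finite_labs)+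
  have "\<exists>(W :: vertex set) G \<phi>. finite W \<and> W \<noteq> {} \<and> \<phi> \<in> Ls a \<rightarrow>\<^sub>E W \<and> eval_comb W G \<phi> a \<noteq> 0"
    using \<open>a \<noteq> 0\<close> Ls(1,2) by (rule eval_comb_nonzero)
  then obtain W :: "vertex set" and G \<phi> where W: "finite W" "W \<noteq> {}" and \<phi>: "\<phi> \<in> Ls a \<rightarrow>\<^sub>E W"
    and nz: "eval_comb W G \<phi> a \<noteq> 0"
    by (elim exE conjE)
  \<comment> \<open>The left side no longer involves labels, so one \<open>\<phi>\<close> serves all
    summands while each is averaged over its own label set.\<close>
  have eq: "eval_comb W G \<phi> (unlabel_comb (b\<^sup>2)) = avg W (Ls b) (\<lambda>\<phi>. (eval_comb W G \<phi> b)\<^sup>2)" for b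
  proof -
    have "labs H \<subseteq> Ls b" if H: "H \<in> Poly_Mapping.keys (b\<^sup>2)" for H
    proof -
      obtain H1 H2 where "H = H1 + H2" "H1 \<in> Poly_Mapping.keys b" "H2 \<in> Poly_Mapping.keys b"
        using H[unfolded power2_eq_square] keys_mult[of b b] by blast
      then show ?thesis using Ls(2)[of H1 b] Ls(2)[of H2 b] by (simp add: labs_plus)
    qed
    with W Ls(1,3) have "avg W (Ls b) (\<lambda>\<phi>. eval_comb W G \<phi> (b\<^sup>2)) = eval_comb W G \<phi> (unlabel_comb (b\<^sup>2))"
      by (rule avg_eval_comb)
    then show ?thesis by (simp add: power2_eq_square eval_comb_mult)
  qed
  have "0 = (\<Sum>b\<leftarrow>as. eval_comb W G \<phi> (unlabel_comb (b\<^sup>2)))"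
    using assms(1) by (simp add: additive.zero[OF additive_eval_comb] flip: eval_comb_sum_list)
  moreover have "0 < eval_comb W G \<phi> (unlabel_comb (a\<^sup>2))"
    unfolding eq using W \<phi> nz Ls(1) by (intro avg_pos[of _ _ _ \<phi>]) simp_all
  moreover have "eval_comb W G \<phi> (unlabel_comb (a\<^sup>2)) \<le> (\<Sum>b\<leftarrow>as. eval_comb W G \<phi> (unlabel_comb (b\<^sup>2)))"
    using assms(2) by (intro member_le_sum_list) (auto simp: eq intro!: avg_nonneg)
  ultimately show False by simp
qed

section \<open>Homogeneous parts\<close>

text \<open>Discarded terms stay in the sum with coefficient 0, so that squares of parts and of the
  whole expand over the same index set.\<close>

definition part :: "(plgraph \<Rightarrow> bool) \<Rightarrow> graph_comb \<Rightarrow> graph_comb" where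
  "part P a = (\<Sum>H\<in>Poly_Mapping.keys a. Poly_Mapping.single H (Poly_Mapping.lookup a H when P H))"

lemma additive_part: "additive (part P)"
  unfolding additive_def part_def
  by (intro allI setsum_keys_plus_distrib) (simp_all add: when_add_distrib single_add)

lemma lookup_part: "Poly_Mapping.lookup (part P a) H = (Poly_Mapping.lookup a H when P H)"
  by (auto simp: part_def lookup_sum lookup_single when_def in_keys_iff)

lemma part_single: "part P (Poly_Mapping.single H c) = Poly_Mapping.single H (c when P H)"
  by (rule poly_mapping_eqI) (auto simp: lookup_part lookup_single when_def)

lemma unlabel_comb_square_sum_single:
  "unlabel_comb ((\<Sum>H\<in>K. Poly_Mapping.single H (c H))\<^sup>2) =
    (\<Sum>H\<in>K. \<Sum>H'\<in>K. Poly_Mapping.single (unlabel (H + H')) (c H * c H'))"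
  by (simp add: power2_eq_square sum_product mult_single additive.sum[OF additive_unlabel_comb]
      unlabel_comb_single)

text \<open>By \<open>deg_plus_eq_iff\<close>, a product of two terms attains the lower bound
  \<open>m\<close> exactly if both terms square to degree \<open>m\<close> and have equal cores. So
  the degree \<open>m\<close> products form one full square for each core \<open>F\<close>; a larger
  \<open>C\<close> only adds zero squares.\<close>

lemma part_unlabel_comb_square:
  assumes min: "\<And>H. H \<in> Poly_Mapping.keys a \<Longrightarrow> m \<le> deg (H + H)"
    and fin: "finite C" and C: "core ` Poly_Mapping.keys a \<subseteq> C"
  shows "part (\<lambda>H. deg H = m) (unlabel_comb (a\<^sup>2)) =
    (\<Sum>F\<in>C. unlabel_comb ((part (\<lambda>H. deg (H + H) = m \<and> core H = F) a)\<^sup>2))"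
proof -
  let ?K = "Poly_Mapping.keys a" and ?\<alpha> = "Poly_Mapping.lookup a"
  let ?Q = "\<lambda>F H. deg (H + H) = m \<and> core H = F"
  have "(\<Sum>F\<in>C. unlabel_comb ((part (?Q F) a)\<^sup>2)) =
    (\<Sum>F\<in>C. \<Sum>H\<in>?K. \<Sum>H'\<in>?K. Poly_Mapping.single (unlabel (H + H'))
       ((?\<alpha> H when ?Q F H) * (?\<alpha> H' when ?Q F H')))"
    by (simp only: part_def unlabel_comb_square_sum_single)
  also have "\<dots> = (\<Sum>H\<in>?K. \<Sum>H'\<in>?K. \<Sum>F\<in>C. Poly_Mapping.single (unlabel (H + H'))
       ((?\<alpha> H when ?Q F H) * (?\<alpha> H' when ?Q F H')))"
    by (subst sum.swap) (intro sum.cong refl sum.swap)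
  also have "\<dots> = (\<Sum>H\<in>?K. \<Sum>H'\<in>?K. Poly_Mapping.single (unlabel (H + H'))
       (?\<alpha> H * ?\<alpha> H' when deg (H + H') = m))"
  proof (intro sum.cong refl)
    fix H H' assume H: "H \<in> ?K" "H' \<in> ?K"
    let ?s = "Poly_Mapping.single (unlabel (H + H'))"
    have "(\<Sum>F\<in>C. ?s ((?\<alpha> H when ?Q F H) * (?\<alpha> H' when ?Q F H'))) =
      (\<Sum>F\<in>C. if F = core H then ?s (?\<alpha> H * ?\<alpha> H' when deg (H + H') = m) else 0)"
      using deg_plus_eq_iff[OF min[OF H(1)] min[OF H(2)]]
      by (intro sum.cong refl) (auto simp: when_def)
    also have "\<dots> = ?s (?\<alpha> H * ?\<alpha> H' when deg (H + H') = m)"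
      using fin C H(1) by auto
    finally show "(\<Sum>F\<in>C. ?s ((?\<alpha> H when ?Q F H) * (?\<alpha> H' when ?Q F H'))) =
      ?s (?\<alpha> H * ?\<alpha> H' when deg (H + H') = m)" .
  qed
  also have "\<dots> = part (\<lambda>H. deg H = m) (unlabel_comb ((\<Sum>H\<in>?K. Poly_Mapping.single H (?\<alpha> H))\<^sup>2))"
    by (simp only: unlabel_comb_square_sum_single additive.sum[OF additive_part] part_single deg_unlabel)
  finally show ?thesis by (simp add: sum_single_lookup)
qed

lemma part_sum_list: "part P (\<Sum>x\<leftarrow>xs. f x) = (\<Sum>x\<leftarrow>xs. part P (f x))"
  by (induction xs) (simp_all add: additive.zero[OF additive_part] additive.add[OF additive_part])

section \<open>The part of least degree\<close>

theorem theorem2p7: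
  fixes f :: graph_comb and d :: nat
  assumes "f \<in> unlabeled_combs" and "homogeneous d f" and "sos f"
  shows "\<exists>as. sos_expression f as \<and>
    (\<forall>a \<in> set as. \<forall>H \<in> Poly_Mapping.keys a. \<forall>H' \<in> Poly_Mapping.keys a. deg (H + H') = d)"
proof -
  obtain as where f: "f = (\<Sum>a\<leftarrow>as. unlabel_comb (a\<^sup>2))"
    using assms(3) by (auto simp: sos_def sos_expression_def)
  define K where "K = (\<Union>a\<in>set as. Poly_Mapping.keys a)"
  have K: "finite K" "\<And>a. a \<in> set as \<Longrightarrow> Poly_Mapping.keys a \<subseteq> K" by (auto simp: K_def)
  show ?thesis
  proof (cases "K = {}")
    \<comment> \<open>All \<open>a\<close> are zero, so the degree condition is vacuous.\<close>
    case True
    then show ?thesis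
      using f by (intro exI[of _ as]) (auto simp: sos_expression_def K_def)
  next
    case False
    \<comment> \<open>One minimum for all \<open>a\<close> together, since only the total degree
      \<open>m\<close> part can be compared with \<open>f\<close>.\<close>
    define m where "m = Min ((\<lambda>H. deg (H + H)) ` K)"
    have m_le: "m \<le> deg (H + H)" if "H \<in> K" for H using that K(1) by (simp add: m_def)
    have "m \<in> (\<lambda>H. deg (H + H)) ` K" using K(1) False by (simp add: m_def)
    then obtain H0 where H0: "H0 \<in> K" "deg (H0 + H0) = m" by blast
    \<comment> \<open>A list without repetition turns the sum over cores into a sum over list
      entries. It serves every \<open>a\<close>; cores absent from \<open>a\<close> give zero
      parts.\<close>
    obtain Cs where Cs: "set Cs = core ` K" "distinct Cs"
      using K(1) finite_distinct_list[of "core ` K"] by blast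
    define g where "g a F = part (\<lambda>H. deg (H + H) = m \<and> core H = F) a" for a F
    define bs where "bs = concat (map (\<lambda>a. map (g a) Cs) as)"
    have "part (\<lambda>H. deg H = m) f = (\<Sum>a\<leftarrow>as. part (\<lambda>H. deg H = m) (unlabel_comb (a\<^sup>2)))"
      by (simp only: f part_sum_list)
    also have "\<dots> = (\<Sum>a\<leftarrow>as. \<Sum>F\<leftarrow>Cs. unlabel_comb ((g a F)\<^sup>2))"
    proof (intro arg_cong[of _ _ sum_list] map_cong refl)
      fix a assume a: "a \<in> set as"
      then show "part (\<lambda>H. deg H = m) (unlabel_comb (a\<^sup>2)) = (\<Sum>F\<leftarrow>Cs. unlabel_comb ((g a F)\<^sup>2))"
        unfolding sum_list_distinct_conv_sum_set[OF Cs(2)] g_def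
        using K m_le by (intro part_unlabel_comb_square) (auto simp: Cs(1))
    qed
    also have "\<dots> = (\<Sum>b\<leftarrow>bs. unlabel_comb (b\<^sup>2))"
      unfolding bs_def by (induction as) (simp_all add: comp_def)
    finally have sum_bs: "part (\<lambda>H. deg H = m) f = (\<Sum>b\<leftarrow>bs. unlabel_comb (b\<^sup>2))" .
    \<comment> \<open>Homogeneity leaves either all of \<open>f\<close> or nothing.\<close>
    have part_f: "part (\<lambda>H. deg H = m) f = (if m = d then f else 0)"
      using assms(2) by (intro poly_mapping_eqI) (auto simp: lookup_part when_def homogeneous_def in_keys_iff)
    have "m = d"
    proof (rule ccontr)
      assume "m \<noteq> d"
      then have "(\<Sum>b\<leftarrow>bs. unlabel_comb (b\<^sup>2)) = 0" using sum_bs part_f by simp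
      moreover obtain a where a: "a \<in> set as" "H0 \<in> Poly_Mapping.keys a"
        using H0(1) by (auto simp: K_def)
      \<comment> \<open>This part retains the term of \<open>H0\<close>, so it cannot be
        zero.\<close>
      moreover have "g a (core H0) \<in> set bs"
        using a(1) H0(1) by (auto simp: bs_def Cs(1))
      ultimately have "g a (core H0) = 0" using sum_squares_eq_0 by blast
      then have "Poly_Mapping.lookup (g a (core H0)) H0 = 0" by simp
      then show False using a(2) H0(2) by (simp add: g_def lookup_part in_keys_iff)
    qed
    \<comment> \<open>Constituents of one \<open>b\<close> share a core and square to degree
      \<open>m\<close>, so \<open>deg_plus_eq_iff\<close> applies to every pair.\<close>
    moreover have "deg (H + H') = m"
      if b: "b \<in> set bs" and H: "H \<in> Poly_Mapping.keys b" "H' \<in> Poly_Mapping.keys b" for b H H'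
    proof -
      obtain a F where "b = g a F" using b by (auto simp: bs_def)
      then have "deg (J + J) = m \<and> core J = F" if "J \<in> Poly_Mapping.keys b" for J
        using that by (auto simp: g_def lookup_part in_keys_iff when_def split: if_splits)
      then show ?thesis using H deg_plus_eq_iff[of m H H'] by simp
    qed
    ultimately show ?thesis
      using sum_bs part_f by (intro exI[of _ bs]) (auto simp: sos_expression_def)
  qed
qed

end
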